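(* Let $G$ be $\mathrm{Path}(\mathbf{k})$ or $\mathrm{Cycle}(\mathbf{k})$ for a sequence $\mathbf{k}$ of positive integers. An ample framing of $G$ is locally anti-blocking if and only if each inner route of $G$ is a leg.
   Context: A DAG is a finite acyclic directed graph, multiple edges allowed, with one source and one sink. An inner vertex is a vertex that is neither the source nor the sink; the inner graph is the directed subgraph induced by the inner vertices. An inner route is a maximal directed path of the inner graph. $G$ is full if every inner vertex has indegree $2$ and outdegree $2$. A route is a directed path from the source to the sink. Ample framing: for a full DAG, an ample framing $F$ is the same as a labeling of the edges by $\{1,2\}$ such that at every inner vertex the two incoming edges have distinct labels and the two outgoing edges have distinct labels. A leg is an inner route whose edge labels are constant. $\mathbf{g}$-polytope: with inner vertices $1,\dots,n$, the $\mathbf{g}$-vector of a route $R$ is $\mathbf{g}(R)=(a_v)_v\in\mathbb{Z}^n$, where $a_v=-1$ if $R$ enters $v$ by an edge labeled $1$ and leaves by an edge labeled $2$; $a_v=1$ if $R$ enters $v$ by an edge labeled $2$ and leaves by an edge labeled $1$; and $a_v=0$ otherwise. The $\mathbf{g}$-polytope of $(G,F)$ is the convex hull of the $\mathbf{g}$-vectors of all routes. Locally anti-blocking: a polytope $Q\subseteq\mathbb{R}^d_{\ge 0}$ is anti-blocking if $x\in Q$ and $0\le y_i\le x_i$ for all $i$ imply $y\in Q$. A polytope $P\subset\mathbb{R}^d$ is locally anti-blocking if for every $\sigma\in\{-1,1\}^d$ the set $(\sigma P)\cap\mathbb{R}^d_{\ge0}$ is anti-blocking, where $\sigma x=(\sigma_1x_1,\dots,\sigma_dx_d)$.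 An ample framing is locally anti-blocking if the $\mathbf{g}$-polytope of $(G,F)$ is locally anti-blocking. For a sequence $\mathbf{k}=(k_1,\dots,k_r)$ of positive integers, $\mathrm{Path}(\mathbf{k})$ denotes a full DAG (no direct source-to-sink edge) whose inner graph consists of $r$ inner routes of lengths $k_1,\dots,k_r$ concatenated so that the inner graph, viewed as an undirected graph, is an undirected path of length $k_1+\cdots+k_r$. $\mathrm{Cycle}(\mathbf{k})$ denotes a full DAG (no direct source-to-sink edge) whose inner graph consists of $r$ inner routes of lengths $k_1,\dots,k_r$ concatenated so that the inner graph, viewed as an undirected graph, is an undirected cycle of length $k_1+\cdots+k_r$ ($r$ is necessarily even; a cycle of length $2$ is a pair of parallel edges). *)

theory Defs
  imports
    "HOL-Analysis.Analysis"
    "Graph_Theory.Digraph_Component"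
begin

section \<open>DAGs, routes and inner routes\<close>

definition is_source :: "('v, 'e) pre_digraph \<Rightarrow> 'v \<Rightarrow> bool" where
  "is_source G v \<longleftrightarrow> v \<in> verts G \<and> in_degree G v = 0"

definition is_sink :: "('v, 'e) pre_digraph \<Rightarrow> 'v \<Rightarrow> bool" where
  "is_sink G v \<longleftrightarrow> v \<in> verts G \<and> out_degree G v = 0"

definition dag :: "('v, 'e) pre_digraph \<Rightarrow> bool" where
  "dag G \<longleftrightarrow> fin_digraph G \<and> (\<nexists>c. pre_digraph.cycle G c) \<and>
     (\<exists>!s. is_source G s) \<and> (\<exists>!t. is_sink G t)"

definition inner_vertices :: "('v, 'e) pre_digraph \<Rightarrow> 'v set" where
  "inner_vertices G = {v \<in> verts G. \<not> is_source G v \<and> \<not> is_sink G v}"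

definition inner_graph :: "('v, 'e) pre_digraph \<Rightarrow> ('v, 'e) pre_digraph" where
  "inner_graph G = G \<restriction> inner_vertices G"

definition full_dag :: "('v, 'e) pre_digraph \<Rightarrow> bool" where
  "full_dag G \<longleftrightarrow> dag G \<and> (\<forall>v \<in> inner_vertices G. in_degree G v = 2 \<and> out_degree G v = 2)"

definition route :: "('v, 'e) pre_digraph \<Rightarrow> 'e list \<Rightarrow> bool" where
  "route G p \<longleftrightarrow> (\<exists>s t. is_source G s \<and> is_sink G t \<and> pre_digraph.apath G s p t)"

text \<open>
  A path is given by its end vertices and its list of arcs; it is maximal if it is not a proper
  contiguous part of a longer path. The condition on \<open>xs\<close> places the start vertex \<open>u\<close>
  correctly, which matters only for paths without arcs.
\<close>
definition maximal_path :: "('v, 'e) pre_digraph \<Rightarrow> 'v \<Rightarrow> 'e list \<Rightarrow> 'v \<Rightarrow> bool" where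
  "maximal_path H u p v \<longleftrightarrow> pre_digraph.apath H u p v \<and>
     (\<forall>xs ys w z. pre_digraph.apath H w (xs @ p @ ys) z \<and> pre_digraph.awalk H w xs u \<longrightarrow>
        xs = [] \<and> ys = [])"

definition inner_route :: "('v, 'e) pre_digraph \<Rightarrow> 'v \<Rightarrow> 'e list \<Rightarrow> 'v \<Rightarrow> bool" where
  "inner_route G u p v \<longleftrightarrow> maximal_path (inner_graph G) u p v"


section \<open>Ample framings and legs\<close>

text \<open>
  For a full DAG an ample framing amounts to a labelling of the edges by 1 and 2 that separates
  the incoming and separates the outgoing edges of every inner vertex; edges at the source and
  the sink are not constrained further.
\<close>
definition ample_framing :: "('v, 'e) pre_digraph \<Rightarrow> ('e \<Rightarrow> nat) \<Rightarrow> bool" where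
  "ample_framing G F \<longleftrightarrow> (\<forall>e \<in> arcs G. F e \<in> {1, 2}) \<and>
     (\<forall>v \<in> inner_vertices G. inj_on F (in_arcs G v) \<and> inj_on F (out_arcs G v))"

definition leg :: "('v, 'e) pre_digraph \<Rightarrow> ('e \<Rightarrow> nat) \<Rightarrow> 'v \<Rightarrow> 'e list \<Rightarrow> 'v \<Rightarrow> bool" where
  "leg G F u p v \<longleftrightarrow> inner_route G u p v \<and> (\<exists>c. \<forall>e \<in> set p. F e = c)"


section \<open>The g-polytope\<close>

text \<open>
  The function \<open>vert\<close> numbers the inner vertices of \<open>G\<close> by the coordinates of \<open>real^'n\<close>.
  Routes visit a vertex at most once, so the edges \<open>e\<close> and \<open>f\<close> below are consecutive in \<open>p\<close>.
\<close>
definition passes ::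
    "('v, 'e) pre_digraph \<Rightarrow> ('e \<Rightarrow> nat) \<Rightarrow> 'e list \<Rightarrow> 'v \<Rightarrow> nat \<Rightarrow> nat \<Rightarrow> bool" where
  "passes G F p v a b \<longleftrightarrow>
     (\<exists>e \<in> set p. head G e = v \<and> F e = a) \<and> (\<exists>f \<in> set p. tail G f = v \<and> F f = b)"

definition g_vector ::
    "('v, 'e) pre_digraph \<Rightarrow> ('e \<Rightarrow> nat) \<Rightarrow> ('n \<Rightarrow> 'v) \<Rightarrow> 'e list \<Rightarrow> real^'n" where
  "g_vector G F vert p =
     (\<chi> i. if passes G F p (vert i) 1 2 then -1
          else if passes G F p (vert i) 2 1 then 1
          else 0)"

definition g_polytope ::
    "('v, 'e) pre_digraph \<Rightarrow> ('e \<Rightarrow> nat) \<Rightarrow> ('n::finite \<Rightarrow> 'v) \<Rightarrow> (real^'n) set" where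
  "g_polytope G F vert = convex hull {g_vector G F vert p |p. route G p}"


section \<open>Locally anti-blocking polytopes\<close>

definition nonneg_orthant :: "(real^'n) set" where
  "nonneg_orthant = {x. \<forall>i. 0 \<le> x $ i}"

definition anti_blocking :: "(real^'n::finite) set \<Rightarrow> bool" where
  "anti_blocking Q \<longleftrightarrow> polytope Q \<and> Q \<subseteq> nonneg_orthant \<and>
     (\<forall>x \<in> Q. \<forall>y. (\<forall>i. 0 \<le> y $ i \<and> y $ i \<le> x $ i) \<longrightarrow> y \<in> Q)"

definition locally_anti_blocking :: "(real^'n::finite) set \<Rightarrow> bool" where
  "locally_anti_blocking P \<longleftrightarrow> polytope P \<and>
     (\<forall>\<sigma> :: real^'n. (\<forall>i. \<sigma> $ i \<in> {-1, 1}) \<longrightarrow>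
        anti_blocking ((\<lambda>x. \<chi> i. \<sigma> $ i * x $ i) ` P \<inter> nonneg_orthant))"

definition locally_anti_blocking_framing ::
    "('v, 'e) pre_digraph \<Rightarrow> ('e \<Rightarrow> nat) \<Rightarrow> ('n::finite \<Rightarrow> 'v) \<Rightarrow> bool" where
  "locally_anti_blocking_framing G F vert \<longleftrightarrow> locally_anti_blocking (g_polytope G F vert)"


section \<open>Path(k) and Cycle(k)\<close>

text \<open>
  \<open>vs\<close> and \<open>es\<close> list all vertices and all arcs of \<open>H\<close> in the order in which they occur along an
  undirected path (resp. cycle); every arc may point in either direction.
\<close>
definition undirected_path :: "('v, 'e) pre_digraph \<Rightarrow> 'v list \<Rightarrow> 'e list \<Rightarrow> bool" where
  "undirected_path H vs es \<longleftrightarrow>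
     distinct vs \<and> set vs = verts H \<and> distinct es \<and> set es = arcs H \<and>
     length vs = length es + 1 \<and>
     (\<forall>i < length es. {tail H (es ! i), head H (es ! i)} = {vs ! i, vs ! (i + 1)})"

definition undirected_cycle :: "('v, 'e) pre_digraph \<Rightarrow> 'v list \<Rightarrow> 'e list \<Rightarrow> bool" where
  "undirected_cycle H vs es \<longleftrightarrow>
     distinct vs \<and> set vs = verts H \<and> distinct es \<and> set es = arcs H \<and>
     length vs = length es \<and> 2 \<le> length es \<and>
     (\<forall>i < length es. {tail H (es ! i), head H (es ! i)} =
        {vs ! i, vs ! ((i + 1) mod length es)})"

text \<open>
  The arc list \<open>es\<close> is the concatenation of inner routes of lengths \<open>ks\<close>, each of which may be
  traversed forwards or backwards. Maximality of inner routes forces the directions of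
  consecutive routes to alternate.
\<close>
definition concat_inner_routes :: "('v, 'e) pre_digraph \<Rightarrow> nat list \<Rightarrow> 'e list \<Rightarrow> bool" where
  "concat_inner_routes G ks es \<longleftrightarrow>
     (\<exists>ps. map length ps = ks \<and> es = concat ps \<and>
        (\<forall>p \<in> set ps. \<exists>u v. inner_route G u p v \<or> inner_route G u (rev p) v))"

definition no_source_sink_arc :: "('v, 'e) pre_digraph \<Rightarrow> bool" where
  "no_source_sink_arc G \<longleftrightarrow> \<not> (\<exists>e \<in> arcs G. is_source G (tail G e) \<and> is_sink G (head G e))"

definition is_Path :: "nat list \<Rightarrow> ('v, 'e) pre_digraph \<Rightarrow> bool" where
  "is_Path ks G \<longleftrightarrow> full_dag G \<and> no_source_sink_arc G \<and>
     (\<exists>vs es. undirected_path (inner_graph G) vs es \<and> concat_inner_routes G ks es)"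

definition is_Cycle :: "nat list \<Rightarrow> ('v, 'e) pre_digraph \<Rightarrow> bool" where
  "is_Cycle ks G \<longleftrightarrow> full_dag G \<and> no_source_sink_arc G \<and>
     (\<exists>vs es. undirected_cycle (inner_graph G) vs es \<and> concat_inner_routes G ks es)"

end

theory Submission
  imports Defs
begin

text \<open>
  A polytope is locally anti-blocking iff it is closed under replacing any one coordinate by \<open>0\<close>.
  By convexity and linearity it suffices to test this on the generators. The g-polytope of a full
  DAG always contains all \<open>\<plusminus>e\<^sub>v\<close>, so if each g-vector has at most two nonzero coordinates, setting
  one of them to \<open>0\<close> stays inside; this is the case if all inner routes are legs.

  Conversely, let \<open>f\<close> from \<open>y\<close> to \<open>v\<close> and \<open>h\<close> from \<open>v\<close> to \<open>z\<close> be inner arcs with labels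
  \<open>a \<noteq> b\<close>, and put \<open>\<nu> = b - a\<close>. Only a route through both \<open>f\<close> and \<open>h\<close> can have coordinate
  \<open>\<nu>\<close> at both \<open>y\<close> and \<open>z\<close>, and then its coordinate at \<open>v\<close> is \<open>-\<nu>\<close>. Hence
  \<open>\<nu> (2 x\<^sub>y + 2 x\<^sub>z + x\<^sub>v) \<le> 3\<close> on the g-polytope, but such a route exists, and setting its
  coordinate at \<open>v\<close> to \<open>0\<close> gives the value \<open>4\<close>.
\<close>

section \<open>Coordinate projections\<close>

definition zero_coord :: "'n \<Rightarrow> real^'n \<Rightarrow> real^'n::finite" where
  "zero_coord i x = (\<chi> j. if j = i then 0 else x $ j)"

lemma zero_coord_nth [simp]: "zero_coord i x $ j = (if j = i then 0 else x $ j)"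
  by (simp add: zero_coord_def)

lemma linear_zero_coord: "linear (zero_coord i)"
  by (rule linearI) (simp_all add: vec_eq_iff)

text \<open>Scale one coordinate at a time: multiplying coordinate \<open>k\<close> by
  \<open>c k\<close> is the convex combination, with weights \<open>c k\<close> and
  \<open>1 - c k\<close>, of the point and its image under \<open>zero_coord k\<close>.\<close>

lemma convex_box_mem:
  fixes P :: "(real^'n::finite) set"
  assumes "convex P" and closed: "\<And>i x. x \<in> P \<Longrightarrow> zero_coord i x \<in> P"
    and "x \<in> P" and c: "\<And>i. 0 \<le> c i \<and> c i \<le> 1"
  shows "(\<chi> i. c i * x $ i) \<in> P"
proof -
  have "(\<chi> i. if i \<in> I then c i * x $ i else x $ i) \<in> P" if "finite I" for I
    using that
  proof (induction I)
    case empty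
    have "(\<chi> i. x $ i) = x"
      by (simp add: vec_eq_iff)
    then show ?case
      using \<open>x \<in> P\<close> by simp
  next
    case (insert k I)
    let ?u = "\<chi> i. if i \<in> I then c i * x $ i else x $ i"
    have "c k *\<^sub>R ?u + (1 - c k) *\<^sub>R zero_coord k ?u \<in> P"
      using insert closed c[of k] by (intro convexD[OF \<open>convex P\<close>]) auto
    also have "c k *\<^sub>R ?u + (1 - c k) *\<^sub>R zero_coord k ?u =
        (\<chi> i. if i \<in> insert k I then c i * x $ i else x $ i)"
      using insert.hyps by (auto simp: vec_eq_iff algebra_simps)
    finally show ?case .
  qed
  from this[of UNIV] show ?thesis
    by simp
qed

lemma linear_sign_change: "linear (\<lambda>x :: real^'n::finite. \<chi> i. \<sigma> $ i * x $ i)"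
  by (rule linearI) (simp_all add: vec_eq_iff algebra_simps)

lemma polyhedron_nonneg_orthant: "polyhedron (nonneg_orthant :: (real^'n::finite) set)"
proof -
  have "nonneg_orthant = (\<Inter>i. {x :: real^'n. axis i 1 \<bullet> x \<ge> 0})"
    by (auto simp: nonneg_orthant_def inner_axis')
  moreover have "polyhedron \<dots>"
    by (rule polyhedron_Inter) (auto intro: polyhedron_halfspace_ge)
  ultimately show ?thesis
    by simp
qed

lemma locally_anti_blocking_iff_zero_coord:
  fixes P :: "(real^'n::finite) set"
  assumes "polytope P"
  shows "locally_anti_blocking P \<longleftrightarrow> (\<forall>i. \<forall>x \<in> P. zero_coord i x \<in> P)"
proof
  assume lab: "locally_anti_blocking P"
  show "\<forall>i. \<forall>x \<in> P. zero_coord i x \<in> P"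
  proof (intro allI ballI)
    fix i x assume "x \<in> P"
    \<comment> \<open>These signs move \<open>x\<close> into the nonnegative orthant, where
      anti-blocking allows one coordinate to be lowered to 0. The sign change is an involution, so
      the result can be carried back to \<open>P\<close>.\<close>
    define \<sigma> :: "real^'n" where "\<sigma> = (\<chi> j. if x $ j \<ge> 0 then 1 else -1)"
    let ?s = "\<lambda>x :: real^'n. \<chi> i. \<sigma> $ i * x $ i"
    have invol: "?s (?s z) = z" for z
      by (simp add: vec_eq_iff \<sigma>_def)
    have "anti_blocking (?s ` P \<inter> nonneg_orthant)"
      using lab unfolding locally_anti_blocking_def
      by (elim conjE allE[of _ \<sigma>] mp) (simp add: \<sigma>_def)
    moreover have "?s x \<in> ?s ` P \<inter> nonneg_orthant"
      using \<open>x \<in> P\<close> by (auto simp: nonneg_orthant_def \<sigma>_def)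
    moreover have "0 \<le> ?s (zero_coord i x) $ j \<and> ?s (zero_coord i x) $ j \<le> ?s x $ j" for j
      by (simp add: \<sigma>_def)
    ultimately have "?s (zero_coord i x) \<in> ?s ` P \<inter> nonneg_orthant"
      unfolding anti_blocking_def by blast
    then obtain z where "z \<in> P" and "?s (zero_coord i x) = ?s z"
      by auto
    then show "zero_coord i x \<in> P"
      using invol[of z] invol[of "zero_coord i x"] by metis
  qed
next
  assume closed: "\<forall>i. \<forall>x \<in> P. zero_coord i x \<in> P"
  show "locally_anti_blocking P"
    unfolding locally_anti_blocking_def
  proof (intro conjI allI impI assms)
    fix \<sigma> :: "real^'n" assume \<sigma>: "\<forall>i. \<sigma> $ i \<in> {-1, 1}"
    let ?s = "\<lambda>x :: real^'n. \<chi> i. \<sigma> $ i * x $ i"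
    have sq: "\<sigma> $ i * \<sigma> $ i = 1" for i
      using \<sigma>[rule_format, of i] by auto
    show "anti_blocking (?s ` P \<inter> nonneg_orthant)"
      unfolding anti_blocking_def
    proof (intro conjI ballI allI impI)
      show "polytope (?s ` P \<inter> nonneg_orthant)"
        by (intro polytope_Int_polyhedron polytope_linear_image linear_sign_change assms
            polyhedron_nonneg_orthant)
      show "?s ` P \<inter> nonneg_orthant \<subseteq> nonneg_orthant"
        by simp
      fix x y assume "x \<in> ?s ` P \<inter> nonneg_orthant" and y: "\<forall>i. 0 \<le> y $ i \<and> y $ i \<le> x $ i"
      then obtain z where z: "z \<in> P" "x = ?s z"
        by auto
      \<comment> \<open>The ratios describe \<open>y\<close> as a coordinatewise shrinking of
        \<open>x\<close>. Where \<open>x $ i = 0\<close>, also \<open>y $ i = 0\<close>, and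
        division by zero gives \<open>c i = 0\<close>, which still lies in the unit
        interval.\<close>
      define c where "c i = y $ i / x $ i" for i
      have "0 \<le> c i \<and> c i \<le> 1" for i
      proof -
        have "0 \<le> y $ i" "y $ i \<le> x $ i"
          using y by auto
        then show ?thesis
          by (cases "x $ i = 0") (simp_all add: c_def divide_le_eq_1)
      qed
      then have "(\<chi> i. c i * z $ i) \<in> P"
        using closed by (intro convex_box_mem polytope_imp_convex assms z(1)) auto
      moreover have "y = ?s (\<chi> i. c i * z $ i)"
      proof -
        have "y $ i = c i * x $ i" for i
          using y[rule_format, of i] by (cases "x $ i = 0") (auto simp: c_def)
        then show ?thesis
          by (simp add: vec_eq_iff z(2) mult.left_commute)
      qed
      ultimately have "y \<in> ?s ` P"
        by (rule rev_image_eqI)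
      then show "y \<in> ?s ` P \<inter> nonneg_orthant"
        using y by (simp add: nonneg_orthant_def)
    qed
  qed
qed

section \<open>Routes of framed full DAGs\<close>

locale framed_full_dag =
  fixes G :: "('v, 'e) pre_digraph" and F :: "'e \<Rightarrow> nat"
  assumes full: "full_dag G" and ample: "ample_framing G F"

sublocale framed_full_dag \<subseteq> fin_digraph G
  using full by (simp add: full_dag_def dag_def)

context framed_full_dag
begin

lemma acyclic: "\<not> cycle c"
  using full by (auto simp: full_dag_def dag_def)

lemma source_unique: "is_source G s \<Longrightarrow> is_source G s' \<Longrightarrow> s = s'"
  using full by (auto simp: full_dag_def dag_def)

lemma sink_unique: "is_sink G t \<Longrightarrow> is_sink G t' \<Longrightarrow> t = t'"
  using full by (auto simp: full_dag_def dag_def)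

lemma label_cases: "e \<in> arcs G \<Longrightarrow> F e = 1 \<or> F e = 2"
  using ample by (auto simp: ample_framing_def)

text \<open>A repeated vertex would cut out a nonempty closed subwalk, and that would contain a
  cycle. So concatenated walks are automatically simple paths.\<close>

lemma awalk_imp_apath:
  assumes "awalk u p v"
  shows "apath u p v"
proof (rule ccontr)
  assume "\<not> apath u p v"
  then obtain r w where "0 < length r" "awalk w r w"
    using awalk_not_distinct_decomp[OF assms] assms by (auto simp: apath_def)
  then have "closed_w r"
    by (auto simp: closed_w_def)
  then show False
    using closed_w_imp_cycle acyclic by blast
qed

lemma not_source_if_arc: "e \<in> arcs G \<Longrightarrow> \<not> is_source G (head G e)"
  by (auto simp: is_source_def in_degree_def in_arcs_def)

lemma not_sink_if_arc: "e \<in> arcs G \<Longrightarrow> \<not> is_sink G (tail G e)"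
  by (auto simp: is_sink_def out_degree_def out_arcs_def)

lemma source_if_not_inner_tail:
  "e \<in> arcs G \<Longrightarrow> tail G e \<notin> inner_vertices G \<Longrightarrow> is_source G (tail G e)"
  using not_sink_if_arc by (auto simp: inner_vertices_def)

lemma sink_if_not_inner_head:
  "e \<in> arcs G \<Longrightarrow> head G e \<notin> inner_vertices G \<Longrightarrow> is_sink G (head G e)"
  using not_source_if_arc by (auto simp: inner_vertices_def)

section \<open>Following a fixed label through inner vertices\<close>

lemma image_eq_labels:
  assumes "inj_on F A" "card A = 2" "A \<subseteq> arcs G"
  shows "F ` A = {1, 2}"
proof (rule card_subset_eq)
  show "F ` A \<subseteq> {1, 2}"
    using assms(3) label_cases by blast
  show "card (F ` A) = card {1 :: nat, 2}"
    using assms by (simp add: card_image)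
qed simp

lemma in_arc_with_label:
  assumes "v \<in> inner_vertices G" "c \<in> {1, 2}"
  obtains e where "e \<in> arcs G" "head G e = v" "F e = c"
proof -
  have "F ` in_arcs G v = {1, 2}"
    using assms full ample
    by (intro image_eq_labels) (auto simp: full_dag_def ample_framing_def in_degree_def)
  with assms(2) have "c \<in> F ` in_arcs G v"
    by simp
  with that show ?thesis
    by auto
qed

lemma out_arc_with_label:
  assumes "v \<in> inner_vertices G" "c \<in> {1, 2}"
  obtains e where "e \<in> arcs G" "tail G e = v" "F e = c"
proof -
  have "F ` out_arcs G v = {1, 2}"
    using assms full ample
    by (intro image_eq_labels) (auto simp: full_dag_def ample_framing_def out_degree_def)
  with assms(2) have "c \<in> F ` out_arcs G v"
    by simp
  with that show ?thesis
    by auto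
qed

lemma in_arc_label_inj:
  assumes "e \<in> arcs G" "e' \<in> arcs G" "head G e = head G e'" "head G e \<in> inner_vertices G"
    "F e = F e'"
  shows "e = e'"
proof (rule inj_onD)
  show "inj_on F (in_arcs G (head G e))"
    using assms(4) ample by (simp add: ample_framing_def)
qed (use assms in auto)

lemma out_arc_label_inj:
  assumes "e \<in> arcs G" "e' \<in> arcs G" "tail G e = tail G e'" "tail G e \<in> inner_vertices G"
    "F e = F e'"
  shows "e = e'"
proof (rule inj_onD)
  show "inj_on F (out_arcs G (tail G e))"
    using assms(4) ample by (simp add: ample_framing_def)
qed (use assms in auto)

text \<open>Take a longest walk from \<open>v\<close> with constant label \<open>c\<close>; lengths
  are bounded because walks are simple. It cannot end at an inner vertex, which would offer another
  outgoing arc labeled \<open>c\<close>. So it ends at the sink, and it has an arc because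
  \<open>v\<close> is inner.\<close>

lemma constant_label_walk_to_sink:
  assumes "v \<in> inner_vertices G" "c \<in> {1, 2}"
  obtains p t where "is_sink G t" "awalk v p t" "p \<noteq> []" "\<forall>e \<in> set p. F e = c"
proof -
  define W where "W p \<longleftrightarrow> (\<exists>t. awalk v p t) \<and> (\<forall>e \<in> set p. F e = c)" for p
  have "W []"
    using assms(1) by (auto simp: W_def awalk_Nil_iff inner_vertices_def)
  moreover have "\<forall>p. W p \<longrightarrow> length p < card (verts G)"
    unfolding W_def using length_apath_less[OF awalk_imp_apath] by blast
  ultimately obtain p where p: "W p" and max: "\<And>q. W q \<Longrightarrow> length q \<le> length p"
    using ex_has_greatest_nat[of W "[]" length "card (verts G)"] by metis
  from p obtain t where t: "awalk v p t" "\<forall>e \<in> set p. F e = c"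
    by (auto simp: W_def)
  have "t \<notin> inner_vertices G"
  proof
    assume "t \<in> inner_vertices G"
    then obtain e where e: "e \<in> arcs G" "tail G e = t" "F e = c"
      using assms(2) by (rule out_arc_with_label)
    then have "awalk v (p @ [e]) (head G e)"
      using t(1) by (intro awalk_appendI) (auto dest: arc_implies_awalk)
    then have "W (p @ [e])"
      using t(2) e(3) by (auto simp: W_def)
    then show False
      using max by fastforce
  qed
  moreover from this have "p \<noteq> []"
    using t(1) assms(1) by (auto simp: awalk_Nil_iff)
  moreover from this have "last p \<in> arcs G" "head G (last p) = t"
    using t(1) by (auto simp: awalk_conv awalk_verts_conv)
  ultimately show ?thesis
    using that t sink_if_not_inner_head by metis
qed

lemma constant_label_walk_from_source:
  assumes "v \<in> inner_vertices G" "c \<in> {1, 2}"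
  obtains s p where "is_source G s" "awalk s p v" "p \<noteq> []" "\<forall>e \<in> set p. F e = c"
proof -
  define W where "W p \<longleftrightarrow> (\<exists>s. awalk s p v) \<and> (\<forall>e \<in> set p. F e = c)" for p
  have "W []"
    using assms(1) by (auto simp: W_def awalk_Nil_iff inner_vertices_def)
  moreover have "\<forall>p. W p \<longrightarrow> length p < card (verts G)"
    unfolding W_def using length_apath_less[OF awalk_imp_apath] by blast
  ultimately obtain p where p: "W p" and max: "\<And>q. W q \<Longrightarrow> length q \<le> length p"
    using ex_has_greatest_nat[of W "[]" length "card (verts G)"] by metis
  from p obtain s where s: "awalk s p v" "\<forall>e \<in> set p. F e = c"
    by (auto simp: W_def)
  have "s \<notin> inner_vertices G"
  proof
    assume "s \<in> inner_vertices G"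
    then obtain e where e: "e \<in> arcs G" "head G e = s" "F e = c"
      using assms(2) by (rule in_arc_with_label)
    then have "awalk (tail G e) (e # p) v"
      using s(1) by (auto simp: awalk_Cons_iff)
    then have "W (e # p)"
      using s(2) e(3) by (auto simp: W_def)
    then show False
      using max by fastforce
  qed
  moreover from this have "p \<noteq> []"
    using s(1) assms(1) by (auto simp: awalk_Nil_iff)
  moreover from this have "hd p \<in> arcs G" "tail G (hd p) = s"
    using s(1) by (cases p; auto simp: awalk_Cons_iff)+
  ultimately show ?thesis
    using that s source_if_not_inner_tail by metis
qed

section \<open>Routes, their g-vectors and the g-polytope\<close>

lemma routeI: "is_source G s \<Longrightarrow> is_sink G t \<Longrightarrow> awalk s p t \<Longrightarrow> route G p"
  by (auto simp: route_def intro: awalk_imp_apath)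

lemma route_arcs: "route G p \<Longrightarrow> set p \<subseteq> arcs G"
  by (auto simp: route_def apath_def awalk_def)

text \<open>A route visits no vertex twice, so it enters and leaves each vertex by at most one arc.
  This makes the arcs in \<open>passes\<close> unique.\<close>

lemma route_inj:
  assumes "route G p"
  shows "inj_on (head G) (set p)" "inj_on (tail G) (set p)"
proof -
  obtain s t where "cas s p t" "distinct (awalk_verts s p)"
    using assms by (auto simp: route_def apath_def awalk_def)
  then show "inj_on (head G) (set p)"
    using awalk_verts_conv'[of s p t] by (auto simp: distinct_map split: if_splits)
  show "inj_on (tail G) (set p)"
    using \<open>distinct (awalk_verts s p)\<close>
    by (cases "p = []") (auto simp: distinct_map awalk_verts_conv)
qed

lemma finite_routes: "finite {p. route G p}"
proof (rule finite_subset)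
  show "{p. route G p} \<subseteq> (fst \<circ> snd) ` {(u, p, v). apath u p v}"
    by (force simp: route_def)
  show "finite ((fst \<circ> snd) ` {(u, p, v). apath u p v})"
    using apaths_finite_triple by (rule finite_imageI)
qed

text \<open>Since the entering and leaving arcs are unique, the case distinction on labels collapses
  to entering label minus leaving label.\<close>

lemma g_vector_nth:
  assumes "route G p" "e \<in> set p" "f \<in> set p" "head G e = vert i" "tail G f = vert i"
  shows "g_vector G F vert p $ i = real (F e) - real (F f)"
proof -
  have "passes G F p (vert i) a b \<longleftrightarrow> F e = a \<and> F f = b" for a b
    unfolding passes_def using assms route_inj[OF assms(1)] by (metis inj_onD)
  moreover have "F e = 1 \<or> F e = 2" "F f = 1 \<or> F f = 2"
    using assms route_arcs label_cases by blast+
  ultimately show ?thesis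
    by (auto simp: g_vector_def)
qed

lemma g_vector_nonzero:
  assumes "g_vector G F vert p $ i \<noteq> 0"
  obtains e f where "e \<in> set p" "f \<in> set p" "head G e = vert i" "tail G f = vert i" "F e \<noteq> F f"
  using assms by (auto simp: g_vector_def passes_def split: if_splits)

lemma g_vector_range: "g_vector G F vert p $ i \<in> {-1, 0, 1}"
  by (auto simp: g_vector_def)

lemma polytope_g_polytope: "polytope (g_polytope G F vert)"
  unfolding g_polytope_def
  using finite_routes by (intro polytope_convex_hull) (simp add: setcompr_eq_image)

lemma g_vector_in_g_polytope: "route G p \<Longrightarrow> g_vector G F vert p \<in> g_polytope G F vert"
  unfolding g_polytope_def by (rule hull_inc) blast

lemma convex_g_polytope: "convex (g_polytope G F vert)"
  by (intro polytope_imp_convex polytope_g_polytope)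

text \<open>Follow label \<open>c\<close> from the source to \<open>v\<close> and label \<open>d\<close> from \<open>v\<close> to the sink.\<close>
lemma axis_in_g_polytope:
  fixes vert :: "'n::finite \<Rightarrow> 'v"
  assumes "inj vert" "vert i \<in> inner_vertices G" "c \<in> {1, 2}" "d \<in> {1, 2}"
  shows "axis i (real c - real d) \<in> g_polytope G F vert"
proof -
  obtain s p where p: "is_source G s" "awalk s p (vert i)" "p \<noteq> []" "\<forall>e \<in> set p. F e = c"
    using assms by (blast intro: constant_label_walk_from_source)
  obtain t q where q: "is_sink G t" "awalk (vert i) q t" "q \<noteq> []" "\<forall>e \<in> set q. F e = d"
    using assms by (blast intro: constant_label_walk_to_sink)
  have walk: "awalk s (p @ q) t"
    using p q by (blast intro: awalk_appendI)
  then have route: "route G (p @ q)"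
    using p q routeI by blast
  have ends: "head G (last p) = vert i" "tail G (hd q) = vert i"
    using p q by (auto simp: awalk_conv awalk_verts_conv hd_map)
  \<comment> \<open>The concatenation is a simple path, so its two halves share only the vertex
    where they are joined.\<close>
  have common: "w = vert i" if "w \<in> set (awalk_verts s p)" "w \<in> set (awalk_verts (vert i) q)" for w
  proof -
    have "awlast s p = vert i"
      using p(2) by auto
    then have "set (awalk_verts s p) \<inter> set (tl (awalk_verts (vert i) q)) = {}"
      using awalk_imp_apath[OF walk] by (simp add: apath_append_iff)
    moreover have "awalk_verts (vert i) q = vert i # tl (awalk_verts (vert i) q)"
      using q(2) by (metis awalk_verts_non_Nil awhd_of_awalk list.collapse)
    ultimately show ?thesis
      using that by (metis disjoint_iff set_ConsD)
  qed
  have "g_vector G F vert (p @ q) = axis i (real c - real d)"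
    unfolding vec_eq_iff
  proof
    fix j
    show "g_vector G F vert (p @ q) $ j = axis i (real c - real d) $ j"
    proof (cases "j = i")
      case True
      have "g_vector G F vert (p @ q) $ i = real (F (last p)) - real (F (hd q))"
        using p q ends by (intro g_vector_nth route) auto
      then show ?thesis
        using True p q by (simp add: axis_def)
    next
      case False
      have "g_vector G F vert (p @ q) $ j = 0"
      proof (rule ccontr)
        assume "g_vector G F vert (p @ q) $ j \<noteq> 0"
        then obtain e f where ef: "e \<in> set (p @ q)" "f \<in> set (p @ q)" "head G e = vert j"
            "tail G f = vert j" "F e \<noteq> F f"
          by (rule g_vector_nonzero)
        \<comment> \<open>Each half has a constant label, so a label change needs one arc from each
          half; \<open>vert j\<close> then lies on both halves.\<close>
        then have "e \<in> set p \<and> f \<in> set q \<or> e \<in> set q \<and> f \<in> set p"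
          using p q by auto
        then have "vert j = vert i"
          using ef p q common by (metis awalk_verts_arc1 awalk_verts_arc2)
        then show False
          using False \<open>inj vert\<close> by (auto dest: injD)
      qed
      then show ?thesis
        using False by (simp add: axis_def)
    qed
  qed
  then show ?thesis
    using g_vector_in_g_polytope[OF route] by metis
qed

section \<open>Legs\<close>

text \<open>The local form of the condition that all inner routes are legs: no label change between
  consecutive inner arcs.\<close>

definition labels_persist :: bool where
  "labels_persist \<longleftrightarrow> (\<forall>e \<in> arcs (inner_graph G). \<forall>f \<in> arcs (inner_graph G).
     head G e = tail G f \<longrightarrow> F e = F f)"

lemma inner_graph_simps [simp]:
  "verts (inner_graph G) = inner_vertices G"
  "arcs (inner_graph G) =
    {e \<in> arcs G. tail G e \<in> inner_vertices G \<and> head G e \<in> inner_vertices G}"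
  "tail (inner_graph G) = tail G" "head (inner_graph G) = head G"
  by (simp_all add: inner_graph_def induce_subgraph_def)

lemma fin_digraph_inner_graph: "fin_digraph (inner_graph G)"
proof -
  have "finite (inner_vertices G)"
    by (rule finite_subset[OF _ finite_verts]) (auto simp: inner_vertices_def)
  then show ?thesis
    by unfold_locales auto
qed

text \<open>Two consecutive inner arcs extend to a maximal path of the inner graph, so they lie on a
  common inner route. Conversely, equality of consecutive labels propagates along a path by
  induction.\<close>

lemma inner_routes_legs_iff:
  "(\<forall>u p v. inner_route G u p v \<longrightarrow> leg G F u p v) \<longleftrightarrow> labels_persist"
proof
  interpret H: fin_digraph "inner_graph G"
    by (rule fin_digraph_inner_graph)
  assume legs: "\<forall>u p v. inner_route G u p v \<longrightarrow> leg G F u p v"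
  show labels_persist
    unfolding labels_persist_def
  proof (intro ballI impI)
    fix e f
    assume e: "e \<in> arcs (inner_graph G)" and f: "f \<in> arcs (inner_graph G)"
      and ef: "head G e = tail G f"
    \<comment> \<open>The pairs of extensions of \<open>[e, f]\<close> to the left and to the right.
      Path lengths are bounded by the number of inner vertices, so a pair of greatest total length
      exists, and it gives a maximal path.\<close>
    define W where "W = (\<lambda>(xs, ys). \<exists>u v. H.apath u (xs @ [e, f] @ ys) v)"
    have "awalk (tail G e) [e, f] (head G f)"
      using e f ef by (auto simp: awalk_simps)
    then have "apath (tail G e) [e, f] (head G f)"
      by (rule awalk_imp_apath)
    then have "H.apath (tail G e) [e, f] (head G f)"
      using e f ef by (auto simp: apath_simps H.apath_simps)
    then have "W ([], [])"
      by (auto simp: W_def)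
    moreover have "\<forall>q. W q \<longrightarrow> length (fst q) + length (snd q) < card (verts (inner_graph G))"
      by (auto simp: W_def dest!: H.length_apath_less)
    ultimately obtain q where "W q" and
      max: "\<And>q'. W q' \<Longrightarrow> length (fst q') + length (snd q') \<le> length (fst q) + length (snd q)"
      using ex_has_greatest_nat[of W "([], [])" "\<lambda>q. length (fst q) + length (snd q)"
          "card (verts (inner_graph G))"] by metis
    then obtain xs ys u v where q: "q = (xs, ys)" "H.apath u (xs @ [e, f] @ ys) v"
      by (auto simp: W_def)
    have "xs' = [] \<and> ys' = []" if "H.apath w (xs' @ (xs @ [e, f] @ ys) @ ys') z" for xs' ys' w z
    proof -
      have "W (xs' @ xs, ys @ ys')"
        using that by (auto simp: W_def)
      from max[OF this] show ?thesis
        by (simp add: q(1))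
    qed
    then have "inner_route G u (xs @ [e, f] @ ys) v"
      using q(2) unfolding inner_route_def maximal_path_def by blast
    then have "leg G F u (xs @ [e, f] @ ys) v"
      using legs by blast
    then show "F e = F f"
      by (auto simp: leg_def)
  qed
next
  interpret H: fin_digraph "inner_graph G"
    by (rule fin_digraph_inner_graph)
  assume persist: labels_persist
  have const: "\<forall>e \<in> set p. F e = F (hd p)" if "H.awalk u p v" for u p v
    using that
  proof (induction p arbitrary: u)
    case (Cons e p)
    show ?case
    proof (cases p)
      case p: (Cons f p')
      then have "F e = F f"
        using persist Cons.prems unfolding labels_persist_def by (simp add: H.awalk_Cons_iff)
      moreover have "\<forall>e \<in> set p. F e = F f"
        using Cons p by (simp add: H.awalk_Cons_iff)
      ultimately show ?thesis
        by simp
    qed simp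
  qed simp
  show "\<forall>u p v. inner_route G u p v \<longrightarrow> leg G F u p v"
    unfolding leg_def inner_route_def maximal_path_def
    using const H.awalkI_apath by blast
qed

text \<open>Between its first and its last arc a route keeps its label, so its g-vector is supported
  on the head of the first arc and the tail of the last one.\<close>
lemma g_vector_support:
  fixes vert :: "'n::finite \<Rightarrow> 'v"
  assumes labels_persist "bij_betw vert UNIV (inner_vertices G)" "route G p"
  obtains x y where "\<And>i. g_vector G F vert p $ i \<noteq> 0 \<Longrightarrow> vert i = x \<or> vert i = y"
proof -
  \<comment> \<open>\<open>x\<close> is where the arc of \<open>p\<close> leaving the source ends,
    and \<open>y\<close> is where the arc entering the sink starts. If \<open>p\<close> has no arcs,
    their values do not matter.\<close>
  define x where "x = (THE x. \<exists>e \<in> set p. is_source G (tail G e) \<and> head G e = x)"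
  define y where "y = (THE y. \<exists>f \<in> set p. is_sink G (head G f) \<and> tail G f = y)"
  have x: "head G e = x" if "e \<in> set p" "is_source G (tail G e)" for e
    unfolding x_def using that source_unique inj_onD[OF route_inj(2)[OF assms(3)]]
    by (intro the_equality[symmetric]) metis+
  have y: "tail G f = y" if "f \<in> set p" "is_sink G (head G f)" for f
    unfolding y_def using that sink_unique inj_onD[OF route_inj(1)[OF assms(3)]]
    by (intro the_equality[symmetric]) metis+
  have "vert i = x \<or> vert i = y" if nz: "g_vector G F vert p $ i \<noteq> 0" for i
  proof -
    obtain e f where ef: "e \<in> set p" "f \<in> set p" "head G e = vert i" "tail G f = vert i"
        "F e \<noteq> F f"
      using nz by (rule g_vector_nonzero)
    have "vert i \<in> inner_vertices G"
      using assms(2) by (auto simp: bij_betw_def)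
    moreover have "e \<in> arcs G" "f \<in> arcs G"
      using ef route_arcs[OF assms(3)] by auto
    \<comment> \<open>The label changes at \<open>vert i\<close>, so by persistence the two arcs
      cannot both be inner: \<open>e\<close> leaves the source or \<open>f\<close> enters the
      sink.\<close>
    ultimately have "tail G e \<notin> inner_vertices G \<or> head G f \<notin> inner_vertices G"
      using assms(1) ef unfolding labels_persist_def by auto
    then show ?thesis
      using x[of e] y[of f] ef source_if_not_inner_tail[of e] sink_if_not_inner_head[of f]
        \<open>e \<in> arcs G\<close> \<open>f \<in> arcs G\<close> by auto
  qed
  then show ?thesis
    by (rule that)
qed

section \<open>Persistence of labels and local anti-blocking\<close>

lemma locally_anti_blocking_if_labels_persist:
  fixes vert :: "'n::finite \<Rightarrow> 'v"
  assumes labels_persist and bij: "bij_betw vert UNIV (inner_vertices G)"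
  shows "locally_anti_blocking (g_polytope G F vert)"
proof -
  let ?P = "g_polytope G F vert"
  have inj: "inj vert" and inner: "vert i \<in> inner_vertices G" for i
    using bij by (auto simp: bij_betw_def)
  have axes: "axis j (-1) \<in> ?P" "axis j 0 \<in> ?P" "axis j 1 \<in> ?P" for j
    using axis_in_g_polytope[OF inj inner, of 1 2 j] axis_in_g_polytope[OF inj inner, of 1 1 j]
      axis_in_g_polytope[OF inj inner, of 2 1 j] by simp_all
  have gen: "zero_coord i (g_vector G F vert p) \<in> ?P" if p: "route G p" for i p
  proof (cases "g_vector G F vert p $ i = 0")
    case True
    then have "zero_coord i (g_vector G F vert p) = g_vector G F vert p"
      by (simp add: vec_eq_iff)
    then show ?thesis
      using g_vector_in_g_polytope[OF p] by metis
  next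
    case False
    obtain x y where xy: "\<And>k. g_vector G F vert p $ k \<noteq> 0 \<Longrightarrow> vert k = x \<or> vert k = y"
      using g_vector_support[OF assms p] by blast
    \<comment> \<open>Coordinate \<open>i\<close> already occupies one of the two places
      \<open>x\<close>, \<open>y\<close>, so at most one other coordinate is nonzero. If there is
      none, any \<open>j\<close> serves and the projected vector is \<open>axis j 0\<close>.\<close>
    have "\<exists>j. \<forall>k. k \<noteq> i \<and> g_vector G F vert p $ k \<noteq> 0 \<longrightarrow> k = j"
      using xy xy[OF False] injD[OF inj] by metis
    then obtain j where j: "\<And>k. k \<noteq> i \<Longrightarrow> g_vector G F vert p $ k \<noteq> 0 \<Longrightarrow> k = j"
      by blast
    have "zero_coord i (g_vector G F vert p) = axis j (zero_coord i (g_vector G F vert p) $ j)"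
      using j by (auto simp: vec_eq_iff axis_def)
    moreover have "zero_coord i (g_vector G F vert p) $ j \<in> {-1, 0, 1}"
      using g_vector_range[of vert p j] by simp
    ultimately show ?thesis
      using axes[of j] by (metis empty_iff insert_iff)
  qed
  have "zero_coord i x \<in> ?P" if "x \<in> ?P" for i x
  proof -
    let ?S = "{g_vector G F vert p |p. route G p}"
    have "zero_coord i ` ?P = convex hull (zero_coord i ` ?S)"
      unfolding g_polytope_def
      by (rule convex_hull_linear_image[OF linear_zero_coord])
    also have "\<dots> \<subseteq> ?P"
      using gen convex_g_polytope by (intro hull_minimal) auto
    finally show ?thesis
      using that by blast
  qed
  then show ?thesis
    by (simp add: locally_anti_blocking_iff_zero_coord polytope_g_polytope)
qed

lemma labels_persist_if_locally_anti_blocking: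
  fixes vert :: "'n::finite \<Rightarrow> 'v"
  assumes lab: "locally_anti_blocking (g_polytope G F vert)"
    and bij: "bij_betw vert UNIV (inner_vertices G)"
  shows labels_persist
proof (rule ccontr)
  let ?P = "g_polytope G F vert"
  assume "\<not> labels_persist"
  then obtain f h where fh: "f \<in> arcs G" "h \<in> arcs G" "head G f = tail G h" "F f \<noteq> F h"
    and inner: "tail G f \<in> inner_vertices G" "head G f \<in> inner_vertices G"
      "head G h \<in> inner_vertices G"
    unfolding labels_persist_def by auto
  have surj: "\<exists>i. vert i = v" if "v \<in> inner_vertices G" for v
    using that bij unfolding bij_betw_def by (metis imageE)
  obtain i j k where i: "vert i = tail G f" and j: "vert j = head G f" and k: "vert k = head G h"
    using inner surj by metis
  have labels: "F f \<in> {1, 2}" "F h \<in> {1, 2}"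
    using fh label_cases by blast+
  \<comment> \<open>The labels are swapped on purpose: arriving at \<open>tail G f\<close> with
    label \<open>F h\<close> and leaving \<open>head G h\<close> with label \<open>F f\<close> makes
    both outer coordinates equal to \<open>F h - F f\<close>.\<close>
  obtain s p where p: "is_source G s" "awalk s p (tail G f)" "p \<noteq> []" "\<forall>e \<in> set p. F e = F h"
    using constant_label_walk_from_source[OF inner(1) labels(2)] .
  obtain t q where q: "is_sink G t" "awalk (head G h) q t" "q \<noteq> []" "\<forall>e \<in> set q. F e = F f"
    using constant_label_walk_to_sink[OF inner(3) labels(1)] .
  let ?r = "p @ [f, h] @ q"
  have "awalk (tail G f) [f, h] (head G h)"
    using fh by (auto simp: awalk_simps)
  then have "awalk s ?r t"
    using p q by (blast intro: awalk_appendI)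
  then have r: "route G ?r"
    using p q routeI by blast
  have ends: "head G (last p) = tail G f" "tail G (hd q) = head G h"
    using p q by (auto simp: awalk_conv awalk_verts_conv hd_map)
  have "apath (tail G f) [f, h] (head G h)"
    using \<open>awalk (tail G f) [f, h] (head G h)\<close> by (rule awalk_imp_apath)
  \<comment> \<open>The middle vertex differs from both outer ones, so zeroing coordinate
    \<open>j\<close> leaves coordinates \<open>i\<close> and \<open>k\<close> intact.\<close>
  then have distinct: "i \<noteq> j" "j \<noteq> k"
    using i j k fh by (auto simp: apath_simps)
  define \<nu> where "\<nu> = real (F h) - real (F f)"
  have \<nu>: "\<nu> = 1 \<or> \<nu> = -1"
    using labels fh(4) by (auto simp: \<nu>_def)
  define w :: "real^'n" where "w = \<nu> *\<^sub>R (2 *\<^sub>R axis i 1 + 2 *\<^sub>R axis k 1 + axis j 1)"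
  have w: "w \<bullet> x = \<nu> * (2 * x $ i + 2 * x $ k + x $ j)" for x
    by (simp add: w_def inner_add_left inner_axis' algebra_simps)
  \<comment> \<open>After multiplication by \<open>\<nu>\<close> the coordinates lie in -1, 0, 1. If
    both outer ones are 1, the middle one is -1 and the value is 2 + 2 - 1 = 3; otherwise it is at
    most 2 + 0 + 1 = 3.\<close>
  have le3: "w \<bullet> g_vector G F vert c \<le> 3" if c: "route G c" for c
  proof -
    let ?g = "g_vector G F vert c"
    have "?g $ j = - \<nu>" if eq: "?g $ i = \<nu>" "?g $ k = \<nu>"
    proof -
      have lab12: "F e = 1 \<or> F e = 2" if "e \<in> set c" for e
        using that route_arcs[OF c] label_cases by blast
      have "?g $ i \<noteq> 0" "?g $ k \<noteq> 0"
        using eq \<nu> by auto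
      then obtain e f' e' h' where
        1: "e \<in> set c" "f' \<in> set c" "head G e = vert i" "tail G f' = vert i" and
        2: "h' \<in> set c" "e' \<in> set c" "head G h' = vert k" "tail G e' = vert k"
        by (metis g_vector_nonzero)
      have "real (F e) - real (F f') = real (F h) - real (F f)"
        using g_vector_nth[of c e f' vert i, OF c 1] eq by (simp add: \<nu>_def)
      \<comment> \<open>A difference of 1 or -1 between labels from 1 and 2 determines both labels.
        The label of the leaving arc then singles out \<open>f\<close> among the arcs out of
        \<open>vert i\<close>; likewise the entering label singles out \<open>h\<close> at
        \<open>vert k\<close>.\<close>
      then have "F f' = F f"
        using lab12[OF 1(1)] lab12[OF 1(2)] labels fh(4) by auto
      then have "f' = f"
        using 1 i fh inner route_arcs[OF c] by (intro out_arc_label_inj) auto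
      have "real (F h') - real (F e') = real (F h) - real (F f)"
        using g_vector_nth[of c h' e' vert k, OF c 2] eq by (simp add: \<nu>_def)
      then have "F h' = F h"
        using lab12[OF 2(1)] lab12[OF 2(2)] labels fh(4) by auto
      then have "h' = h"
        using 2 k fh inner route_arcs[OF c] by (intro in_arc_label_inj) auto
      have "f \<in> set c" "h \<in> set c" "head G f = vert j" "tail G h = vert j"
        using 1(2) 2(1) \<open>f' = f\<close> \<open>h' = h\<close> fh(3) j by metis+
      from g_vector_nth[of c f h vert j, OF c this] show ?thesis
        unfolding \<nu>_def by linarith
    qed
    then show ?thesis
      using g_vector_range[of vert c i] g_vector_range[of vert c j] g_vector_range[of vert c k] \<nu>
      unfolding w by auto
  qed
  have "?P \<subseteq> {x. w \<bullet> x \<le> 3}"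
    unfolding g_polytope_def using le3 by (intro hull_minimal convex_halfspace_le) auto
  moreover have "zero_coord j (g_vector G F vert ?r) \<in> ?P"
    using lab g_vector_in_g_polytope[OF r]
    unfolding locally_anti_blocking_iff_zero_coord[OF polytope_g_polytope] by blast
  moreover have "g_vector G F vert ?r $ i = \<nu>" "g_vector G F vert ?r $ k = \<nu>"
  proof -
    have "g_vector G F vert ?r $ i = real (F (last p)) - real (F f)"
      using p(3) ends(1) i by (intro g_vector_nth r) simp_all
    then show "g_vector G F vert ?r $ i = \<nu>"
      using p(3,4) by (simp add: \<nu>_def)
    have "g_vector G F vert ?r $ k = real (F h) - real (F (hd q))"
      using q(3) ends(2) k by (intro g_vector_nth r) simp_all
    then show "g_vector G F vert ?r $ k = \<nu>"
      using q(3,4) by (simp add: \<nu>_def)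
  qed
  then have "w \<bullet> zero_coord j (g_vector G F vert ?r) = 4"
    using distinct \<nu> unfolding w by auto
  ultimately show False
    by fastforce
qed

end

theorem corollary3p10:
  fixes G :: "('v, 'e) pre_digraph"
    and F :: "'e \<Rightarrow> nat"
    and ks :: "nat list"
    and vert :: "'n::finite \<Rightarrow> 'v"
  assumes "ks \<noteq> []" and "\<forall>k \<in> set ks. 0 < k"
    and "is_Path ks G \<or> is_Cycle ks G"
    and "bij_betw vert UNIV (inner_vertices G)"
    and "ample_framing G F"
  shows "locally_anti_blocking_framing G F vert \<longleftrightarrow>
    (\<forall>u p v. inner_route G u p v \<longrightarrow> leg G F u p v)"
proof -
  interpret framed_full_dag G F
    using assms(3,5) by unfold_locales (auto simp: is_Path_def is_Cycle_def)
  show ?thesis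
    \<comment> \<open>Both sides of the equivalence are compared with
      \<open>labels_persist\<close>.\<close>
    unfolding locally_anti_blocking_framing_def inner_routes_legs_iff
    using assms(4) locally_anti_blocking_if_labels_persist labels_persist_if_locally_anti_blocking
    by blast
qed

end
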